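(* Let $f,h_1,h_2\in\mathbb{Z}[X]$ and let $(a_n)_{n\in\mathbb{N}}$ be a bounded sequence given by the formula $a_0=h_1(0)$, $a_n=f(n)a_{n-1}+h_1(n)h_2(n)^n$ for $n>0$. Then one of the following conditions is true: (a) $h_1=0$ (and then the sequence $(a_n)_{n\in\mathbb{N}}$ is constantly equal to $0$); (b) $h_2=b$ is a constant polynomial, where $b\in\{-1,0,1\}$. Moreover, (i) if $h_2=1$, then there is an integer $c$ such that either $a_n=c$ for almost all $n\in\mathbb{N}$, or $a_{2n}=c$ and $a_{2n+1}=0$ for all $n\in\mathbb{N}$; (ii) if $h_2=-1$, then there is an integer $c$ such that either $a_n=(-1)^nc$ for almost all $n\in\mathbb{N}$, or $a_{2n}=c$ and $a_{2n+1}=0$ for all $n\in\mathbb{N}$; (iii) if $h_2=0$, then $a_n=0$ for almost all $n\in\mathbb{N}$, or $a_n=h_1(0)$ for all $n\in\mathbb{N}$, or $a_n=(-1)^nh_1(0)$ for all $n\in\mathbb{N}$.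
   Context: $\mathbb{N}=\{0,1,2,\dots\}$. "For almost all $n$" means for all but finitely many $n$. *)

theory Defs
  imports "HOL-Analysis.Analysis" "HOL-Computational_Algebra.Polynomial"
begin

end

theory Submission imports Defs "HOL-Real_Asymp.Real_Asymp"
begin

text \<open>
  A bounded integer sequence has only finitely many pairs of consecutive values \<open>(u, v)\<close>, and
  a polynomial relation in \<open>n\<close> that such a pair satisfies infinitely often is an identity.
  If \<open>h\<^sub>1 \<noteq> 0\<close> and \<open>h\<^sub>2 \<notin> {-1, 0, 1}\<close>, the term \<open>h\<^sub>1(n) h\<^sub>2(n)\<^sup>n\<close> is eventually at least \<open>2\<^sup>n\<close> in
  absolute value, which exceeds every polynomial. If \<open>h\<^sub>2 = 1\<close>, eventually every pair satisfies
  \<open>v = u f + h\<^sub>1\<close> in \<open>\<int>[X]\<close>, so either \<open>a\<close> is eventually constant or two different values of \<open>u\<close>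
  occur; then \<open>f\<close> and \<open>h\<^sub>1\<close> are constants and the recurrence is solved explicitly. The case
  \<open>h\<^sub>2 = -1\<close> reduces to this one for \<open>(-1)\<^sup>n a\<^sub>n\<close> and \<open>-f\<close>, and \<open>h\<^sub>2 = 0\<close> uses the same
  argument with the identity \<open>v = u f\<close>.
\<close>

section \<open>Growth of integer polynomials and powers against a bounded sequence\<close>

lemma Bseq_of_int_iff: "Bseq (\<lambda>n. real_of_int (a n)) \<longleftrightarrow> (\<exists>M. \<forall>n. \<bar>a n\<bar> \<le> M)"
proof
  assume "Bseq (\<lambda>n. real_of_int (a n))"
  then obtain K where K: "\<And>n. \<bar>real_of_int (a n)\<bar> \<le> K"
    unfolding Bseq_def by auto
  have "\<bar>a n\<bar> \<le> \<lfloor>K\<rfloor>" for n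
    using K[of n] by (simp add: le_floor_iff)
  then show "\<exists>M. \<forall>n. \<bar>a n\<bar> \<le> M" by blast
next
  assume "\<exists>M. \<forall>n. \<bar>a n\<bar> \<le> M"
  then obtain M where "\<And>n. \<bar>a n\<bar> \<le> M" by blast
  then show "Bseq (\<lambda>n. real_of_int (a n))"
    by (intro BseqI'[of _ "real_of_int M"]) (metis norm_of_int of_int_abs of_int_le_iff)
qed

lemma eventually_poly_nonzero:
  fixes p :: "int poly"
  assumes "p \<noteq> 0"
  shows "\<forall>\<^sub>F n in sequentially. poly p (int n) \<noteq> 0"
proof -
  have "finite (int -` {x. poly p x = 0})"
    using poly_roots_finite[OF assms] by (rule finite_vimageI) simp
  then show ?thesis
    by (simp add: cofinite_eq_sequentially[symmetric] eventually_cofinite vimage_def)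
qed

text \<open>The factor \<open>n ^ k\<close> is there for the induction: \<open>pCons c p\<close> has
  value \<open>c + n * p(n)\<close> at \<open>n\<close>, and the second summand is the hypothesis
  for \<open>p\<close> with \<open>k\<close> raised by one.\<close>

lemma poly_over_power_tendsto_0:
  "(\<lambda>n. real n ^ k * real_of_int (poly p (int n)) / 2 ^ n) \<longlonglongrightarrow> 0"
proof (induction p arbitrary: k rule: pCons_induct)
  case 0
  show ?case by simp
next
  case (pCons c p)
  have "(\<lambda>n. real n ^ k / 2 ^ n) \<longlonglongrightarrow> 0"
    by real_asymp
  from tendsto_add[OF tendsto_mult_left[OF this, of "real_of_int c"] pCons.IH[of "Suc k"]]
  have "(\<lambda>n. real_of_int c * (real n ^ k / 2 ^ n)
      + real n ^ Suc k * real_of_int (poly p (int n)) / 2 ^ n) \<longlonglongrightarrow> 0"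
    by simp
  moreover have "real_of_int c * (real n ^ k / 2 ^ n)
      + real n ^ Suc k * real_of_int (poly p (int n)) / 2 ^ n
      = real n ^ k * real_of_int (poly (pCons c p) (int n)) / 2 ^ n" for n
    by (simp add: distrib_left add_divide_distrib mult_ac)
  ultimately show ?case by simp
qed

text \<open>The left side has the shape of the bound on
  \<open>\<bar>a n - f(n) * a (n - 1)\<bar>\<close> for a sequence bounded by \<open>M\<close>, to
  be set against an exponential term.\<close>

lemma eventually_poly_less_power:
  fixes p :: "int poly"
  shows "\<forall>\<^sub>F n in sequentially. \<bar>poly p (int n)\<bar> * M + M < 2 ^ n"
proof -
  have "(\<lambda>n. real_of_int \<bar>poly p (int n)\<bar> / 2 ^ n) \<longlonglongrightarrow> 0"
    using tendsto_rabs[OF poly_over_power_tendsto_0[of 0 p]] by simp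
  moreover have "(\<lambda>n. 1 / 2 ^ n :: real) \<longlonglongrightarrow> 0"
    by real_asymp
  ultimately have "(\<lambda>n. real_of_int \<bar>poly p (int n)\<bar> / 2 ^ n * real_of_int M
      + 1 / 2 ^ n * real_of_int M) \<longlonglongrightarrow> 0 * real_of_int M + 0 * real_of_int M"
    by (intro tendsto_intros)
  then have "\<forall>\<^sub>F n in sequentially. real_of_int \<bar>poly p (int n)\<bar> / 2 ^ n * real_of_int M
      + 1 / 2 ^ n * real_of_int M < 1"
    by (intro order_tendstoD(2)[of _ 0]) simp_all
  then show ?thesis
  proof eventually_elim
    case (elim n)
    then have "real_of_int (\<bar>poly p (int n)\<bar> * M + M) < real_of_int (2 ^ n)"
      by (simp add: field_simps)
    then show ?case by (simp only: of_int_less_iff)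
  qed
qed

lemma bounded_power_imp_zero:
  fixes c k M :: int
  assumes "\<bar>k\<bar> \<ge> 2" and bound: "\<And>n. \<bar>c * k ^ n\<bar> \<le> M"
  shows "c = 0"
proof (rule ccontr)
  assume "c \<noteq> 0"
  have "M \<ge> 0" using bound[of 0] by linarith
  \<comment> \<open>The exponent \<open>nat M\<close> is large enough because
    \<open>m < 2 ^ m\<close> for every natural \<open>m\<close>.\<close>
  have "M < int (2 ^ nat M)"
    using less_exp[of "nat M"] by linarith
  also have "\<dots> \<le> \<bar>k\<bar> ^ nat M"
    using power_mono[OF assms(1), of "nat M"] by simp
  also have "\<dots> \<le> \<bar>c\<bar> * \<bar>k\<bar> ^ nat M"
    using mult_right_mono[of 1 "\<bar>c\<bar>" "\<bar>k\<bar> ^ nat M"] \<open>c \<noteq> 0\<close> by simp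
  also have "\<dots> \<le> M"
    using bound[of "nat M"] by (simp add: abs_mult power_abs)
  finally show False by simp
qed

section \<open>Bounded solutions of recurrences with polynomial coefficients\<close>

text \<open>All pairs \<open>(a n, a (Suc n))\<close> lie in a finite box. For each pair
  \<open>w\<close> in it, \<open>?P w\<close> is zero or has no roots at large integers, and one
  threshold serves the whole box. The recurrence makes \<open>Suc n\<close> a root for the pair at
  \<open>n\<close>, so that polynomial is zero.\<close>

lemma eventually_poly_recurrence_identity:
  fixes f h :: "int poly" and a :: "nat \<Rightarrow> int"
  assumes rec: "\<And>n. a (Suc n) = poly f (int (Suc n)) * a n + poly h (int (Suc n))"
    and bound: "\<And>n. \<bar>a n\<bar> \<le> M"
  shows "\<forall>\<^sub>F n in sequentially. [:a (Suc n):] = smult (a n) f + h"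
proof -
  let ?P = "\<lambda>w. smult (fst w) f + h - [:snd w:]"
  have "\<forall>\<^sub>F n in sequentially. \<forall>w\<in>{-M..M} \<times> {-M..M}. ?P w \<noteq> 0 \<longrightarrow> poly (?P w) (int (Suc n)) \<noteq> 0"
  proof (intro eventually_ball_finite ballI)
    fix w
    show "\<forall>\<^sub>F n in sequentially. ?P w \<noteq> 0 \<longrightarrow> poly (?P w) (int (Suc n)) \<noteq> 0"
    proof (cases "?P w = 0")
      case False
      then have "\<forall>\<^sub>F n in sequentially. poly (?P w) (int (Suc n)) \<noteq> 0"
        using eventually_poly_nonzero[OF False] by (subst eventually_sequentially_Suc)
      then show ?thesis by eventually_elim simp
    qed simp
  qed simp
  then show ?thesis
  proof eventually_elim
    case (elim n)
    have "(a n, a (Suc n)) \<in> {-M..M} \<times> {-M..M}"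
      using bound[of n] bound[of "Suc n"] by auto
    with elim have "?P (a n, a (Suc n)) \<noteq> 0 \<longrightarrow> poly (?P (a n, a (Suc n))) (int (Suc n)) \<noteq> 0"
      by blast
    moreover have "poly (?P (a n, a (Suc n))) (int (Suc n)) = 0"
      using rec[of n] by (simp add: mult.commute)
    ultimately show ?case by simp
  qed
qed

lemma const_poly_if_smult_const:
  fixes f :: "int poly"
  assumes "smult d f = [:e:]" "d \<noteq> 0"
  shows "\<exists>k. f = [:k:]"
proof -
  have "degree f = degree (smult d f)"
    using assms(2) by simp
  then have "degree f = 0"
    by (simp add: assms(1))
  then show ?thesis by (metis degree_eq_zeroE)
qed

text \<open>The slope \<open>k\<close> decides: 0 gives a constant sequence, -1 the alternation of
  \<open>c\<close> and 0. For \<open>k = 1\<close> the sequence grows linearly and for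
  \<open>\<bar>k\<bar> \<ge> 2\<close> its differences grow geometrically, so boundedness forces
  \<open>c = 0\<close>.\<close>

lemma bounded_affine_recurrence:
  fixes k c :: int and a :: "nat \<Rightarrow> int"
  assumes "a 0 = c" and rec: "\<And>n. a (Suc n) = k * a n + c" and bound: "\<And>n. \<bar>a n\<bar> \<le> M"
  shows "(\<forall>\<^sub>\<infinity>n. a n = c) \<or> (\<forall>n. a (2 * n) = c \<and> a (2 * n + 1) = 0)"
proof -
  have zero: ?thesis if "c = 0"
  proof -
    have "a n = 0" for n
      by (induction n) (use assms that in auto)
    then show ?thesis using that by simp
  qed
  consider "k = 0" | "k = 1" | "k = -1" | "\<bar>k\<bar> \<ge> 2" by linarith
  then show ?thesis
  proof cases
    case 1
    have "a n = c" for n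
      by (cases n) (use 1 rec assms(1) in auto)
    then show ?thesis by simp
  next
    case 2
    have a: "a n = (int n + 1) * c" for n
      by (induction n) (use 2 rec assms(1) in \<open>auto simp: algebra_simps\<close>)
    have "c = 0"
    proof (rule ccontr)
      assume "c \<noteq> 0"
      have "M \<ge> 0" using bound[of 0] by linarith
      have "M + 1 \<le> (M + 1) * \<bar>c\<bar>"
        using \<open>c \<noteq> 0\<close> \<open>M \<ge> 0\<close> by (simp add: mult_le_cancel_left1)
      also have "\<dots> = \<bar>a (nat M)\<bar>"
        using \<open>M \<ge> 0\<close> by (simp add: a abs_mult)
      finally show False using bound[of "nat M"] by simp
    qed
    then show ?thesis by (rule zero)
  next
    case 3
    have step: "a (Suc n) = c - a n" for n
      using rec[of n] 3 by simp
    have "a (2 * n) = c \<and> a (2 * n + 1) = 0" for n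
    proof (induction n)
      case 0
      show ?case using step[of 0] assms(1) by simp
    next
      case (Suc n)
      then show ?case using step[of "2 * n + 1"] step[of "2 * n + 2"] by simp
    qed
    then show ?thesis by blast
  next
    case 4
    \<comment> \<open>Differences satisfy the homogeneous recurrence with ratio \<open>k\<close>,
      and the first one is \<open>(k * c + c) - c = k * c\<close>.\<close>
    have diff: "a (Suc n) - a n = (k * c) * k ^ n" for n
      by (induction n) (use rec assms(1) in \<open>auto simp: algebra_simps\<close>)
    have "\<bar>(k * c) * k ^ n\<bar> \<le> 2 * M" for n
      using diff[of n] bound[of n] bound[of "Suc n"] by linarith
    from bounded_power_imp_zero[OF 4 this] have "c = 0"
      using 4 by auto
    then show ?thesis by (rule zero)
  qed
qed

lemma bounded_poly_recurrence:
  fixes f h :: "int poly" and a :: "nat \<Rightarrow> int"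
  assumes a0: "a 0 = poly h 0"
    and rec: "\<And>n. a (Suc n) = poly f (int (Suc n)) * a n + poly h (int (Suc n))"
    and bound: "\<And>n. \<bar>a n\<bar> \<le> M"
  shows "\<exists>c. (\<forall>\<^sub>\<infinity>n. a n = c) \<or> (\<forall>n. a (2 * n) = c \<and> a (2 * n + 1) = 0)"
proof -
  obtain N where N: "\<And>n. n \<ge> N \<Longrightarrow> [:a (Suc n):] = smult (a n) f + h"
    using eventually_poly_recurrence_identity[OF rec bound]
    unfolding eventually_sequentially by blast
  show ?thesis
  proof (cases "\<forall>n\<ge>N. a n = a N")
    case True
    then have "\<forall>\<^sub>\<infinity>n. a n = a N"
      unfolding cofinite_eq_sequentially eventually_sequentially by blast
    then show ?thesis by blast
  next
    case False
    then obtain n where n: "n \<ge> N" "a n \<noteq> a N" by blast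
    \<comment> \<open>Subtracting the identities at \<open>n\<close> and \<open>N\<close> eliminates
      \<open>h\<close>, so a nonzero multiple of \<open>f\<close> is constant. Either identity then
      makes \<open>h\<close> constant as well.\<close>
    have "smult (a n - a N) f = [:a (Suc n):] - [:a (Suc N):]"
      unfolding N[OF n(1)] N[OF order_refl] by (simp add: smult_diff_left)
    also have "\<dots> = [:a (Suc n) - a (Suc N):]"
      by simp
    finally have "smult (a n - a N) f = [:a (Suc n) - a (Suc N):]" .
    then obtain k where k: "f = [:k:]"
      using const_poly_if_smult_const n(2) by (metis right_minus_eq)
    have "h = [:a (Suc N):] - smult (a N) f"
      using N[OF order_refl] by simp
    then obtain c where c: "h = [:c:]"
      using k by (auto simp: mult.commute)
    show ?thesis
      by (rule exI, rule bounded_affine_recurrence[where k = k and M = M])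
        (use a0 rec bound k c in \<open>auto simp: mult.commute\<close>)
  qed
qed

text \<open>A single identity at a large \<open>N\<close> suffices: a zero at \<open>N\<close>
  propagates forward, while a nonzero value there makes \<open>f\<close> a constant \<open>k\<close>
  and the sequence geometric.\<close>

lemma bounded_homogeneous_recurrence:
  fixes f :: "int poly" and a :: "nat \<Rightarrow> int"
  assumes rec: "\<And>n. a (Suc n) = poly f (int (Suc n)) * a n"
    and bound: "\<And>n. \<bar>a n\<bar> \<le> M"
  shows "(\<forall>\<^sub>\<infinity>n. a n = 0) \<or> (\<forall>n. a n = a 0) \<or> (\<forall>n. a n = (-1) ^ n * a 0)"
proof -
  obtain N where N: "[:a (Suc N):] = smult (a N) f"
    using eventually_poly_recurrence_identity[of a f 0 M] rec bound
    unfolding eventually_sequentially by auto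
  show ?thesis
  proof (cases "a N = 0")
    case True
    have "a n = 0" if "n \<ge> N" for n
      using that by (induction n rule: dec_induct) (use True rec in auto)
    then show ?thesis
      unfolding cofinite_eq_sequentially eventually_sequentially by blast
  next
    case False
    then obtain k where k: "f = [:k:]"
      using const_poly_if_smult_const[OF N[symmetric]] by blast
    have a: "a n = a 0 * k ^ n" for n
      by (induction n) (use rec k in auto)
    consider "k = 0" | "k = 1" | "k = -1" | "\<bar>k\<bar> \<ge> 2" by linarith
    then show ?thesis
    proof cases
      case 1
      \<comment> \<open>Index 0 is excluded because \<open>0 ^ 0 = 1\<close>.\<close>
      have "\<forall>\<^sub>F n in sequentially. a n = 0"
        using eventually_gt_at_top[of 0]
        by eventually_elim (subst a, use 1 in simp)
      then show ?thesis
        by (simp add: cofinite_eq_sequentially)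
    next
      case 2
      then have "\<forall>n. a n = a 0" using a by (metis mult_1_right power_one)
      then show ?thesis by blast
    next
      case 3
      then have "\<forall>n. a n = (-1) ^ n * a 0" using a by (metis mult.commute)
      then show ?thesis by blast
    next
      case 4
      then have "a 0 = 0"
        using bounded_power_imp_zero[OF 4, of "a 0" M] bound a by metis
      then have "\<forall>n. a n = a 0" using a by (metis mult_zero_left)
      then show ?thesis by blast
    qed
  qed
qed

section \<open>Restriction on the base of the exponential term\<close>

lemma bounded_recurrence_base:
  fixes f h g :: "int poly" and a :: "nat \<Rightarrow> int"
  assumes rec: "\<And>n. a (Suc n) = poly f (int (Suc n)) * a n
      + poly h (int (Suc n)) * poly g (int (Suc n)) ^ Suc n"
    and bound: "\<And>n. \<bar>a n\<bar> \<le> M" and "h \<noteq> 0"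
  shows "\<exists>b\<in>{-1, 0, 1}. g = [:b:]"
proof (rule ccontr)
  assume not_const: "\<not> ?thesis"
  have ne: "\<forall>\<^sub>F n in sequentially. poly g (int n) \<noteq> b" if "b \<in> {-1, 0, 1}" for b
  proof -
    have "g - [:b:] \<noteq> 0" using not_const that by auto
    from eventually_poly_nonzero[OF this] show ?thesis by simp
  qed
  \<comment> \<open>At a large \<open>n\<close> the value of \<open>g\<close> avoids -1, 0, 1 and
    that of \<open>h\<close> is nonzero, so the exponential term is at least \<open>2 ^ n\<close>.
    The recurrence bounds the same term by \<open>\<bar>f(n)\<bar> * M + M\<close>, which is
    smaller.\<close>
  have "\<forall>\<^sub>F n in sequentially. False"
    using ne[of "-1", simplified] ne[of 0, simplified] ne[of 1, simplified]
      eventually_poly_nonzero[OF \<open>h \<noteq> 0\<close>]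
      eventually_poly_less_power[of f M] eventually_gt_at_top[of 0]
  proof eventually_elim
    case (elim n)
    then obtain m where m: "n = Suc m" by (cases n) auto
    have "\<bar>poly g (int n)\<bar> \<ge> 2" using elim by linarith
    then have "2 ^ n \<le> \<bar>poly g (int n)\<bar> ^ n"
      by (intro power_mono) auto
    also have "\<dots> \<le> \<bar>poly h (int n)\<bar> * \<bar>poly g (int n)\<bar> ^ n"
      using elim by (simp add: mult_le_cancel_right1)
    also have "\<dots> = \<bar>a n - poly f (int n) * a m\<bar>"
      using rec[of m] m by (simp add: abs_mult power_abs)
    also have "\<dots> \<le> \<bar>a n\<bar> + \<bar>poly f (int n)\<bar> * \<bar>a m\<bar>"
      by (metis abs_mult abs_triangle_ineq4)
    also have "\<dots> \<le> M + \<bar>poly f (int n)\<bar> * M"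
      by (intro add_mono mult_left_mono bound) simp
    finally show False using elim by linarith
  qed
  then show False by simp
qed

theorem theorem9:
  fixes f h\<^sub>1 h\<^sub>2 :: "int poly" and a :: "nat \<Rightarrow> int"
  assumes a_0: "a 0 = poly h\<^sub>1 0"
    and a_rec: "\<And>n. n > 0 \<Longrightarrow>
      a n = poly f (int n) * a (n - 1) + poly h\<^sub>1 (int n) * poly h\<^sub>2 (int n) ^ n"
    and a_bounded: "Bseq (\<lambda>n. real_of_int (a n))"
  shows "((h\<^sub>1 = 0 \<and> (\<forall>n. a n = 0)) \<or> (\<exists>b\<in>{-1, 0, 1}. h\<^sub>2 = [:b:])) \<and>
    (h\<^sub>2 = 1 \<longrightarrow>
      (\<exists>c. (\<forall>\<^sub>\<infinity>n. a n = c) \<or> (\<forall>n. a (2 * n) = c \<and> a (2 * n + 1) = 0))) \<and>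
    (h\<^sub>2 = -1 \<longrightarrow>
      (\<exists>c. (\<forall>\<^sub>\<infinity>n. a n = (-1) ^ n * c) \<or> (\<forall>n. a (2 * n) = c \<and> a (2 * n + 1) = 0))) \<and>
    (h\<^sub>2 = 0 \<longrightarrow>
      (\<forall>\<^sub>\<infinity>n. a n = 0) \<or> (\<forall>n. a n = poly h\<^sub>1 0) \<or> (\<forall>n. a n = (-1) ^ n * poly h\<^sub>1 0))"
proof -
  obtain M where bound: "\<And>n. \<bar>a n\<bar> \<le> M"
    using a_bounded unfolding Bseq_of_int_iff by blast
  have rec: "a (Suc n) = poly f (int (Suc n)) * a n
      + poly h\<^sub>1 (int (Suc n)) * poly h\<^sub>2 (int (Suc n)) ^ Suc n" for n
    using a_rec[of "Suc n"] by simp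
  have "(h\<^sub>1 = 0 \<and> (\<forall>n. a n = 0)) \<or> (\<exists>b\<in>{-1, 0, 1}. h\<^sub>2 = [:b:])"
  proof (cases "h\<^sub>1 = 0")
    case True
    have "a n = 0" for n
      by (induction n) (use True a_0 rec in auto)
    then show ?thesis using True by blast
  next
    case False
    show ?thesis
      using bounded_recurrence_base[OF rec bound False] by blast
  qed
  moreover have "\<exists>c. (\<forall>\<^sub>\<infinity>n. a n = c) \<or> (\<forall>n. a (2 * n) = c \<and> a (2 * n + 1) = 0)" if "h\<^sub>2 = 1"
    by (rule bounded_poly_recurrence[where f = f and h = h\<^sub>1 and M = M])
      (use a_0 rec bound that in simp_all)
  moreover have "\<exists>c. (\<forall>\<^sub>\<infinity>n. a n = (-1) ^ n * c) \<or> (\<forall>n. a (2 * n) = c \<and> a (2 * n + 1) = 0)"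
    if "h\<^sub>2 = -1"
  proof -
    \<comment> \<open>The twist cancels the sign of the exponential term; the shift from
      \<open>n\<close> to \<open>Suc n\<close> leaves one extra sign, which turns \<open>f\<close>
      into \<open>- f\<close>.\<close>
    define b where "b n = (-1) ^ n * a n" for n
    have a_b: "a n = (-1) ^ n * b n" for n
      by (simp add: b_def flip: mult.assoc power_add)
    have "\<exists>c. (\<forall>\<^sub>\<infinity>n. b n = c) \<or> (\<forall>n. b (2 * n) = c \<and> b (2 * n + 1) = 0)"
    proof (rule bounded_poly_recurrence[of _ h\<^sub>1 "- f"])
      show "b 0 = poly h\<^sub>1 0" using a_0 by (simp add: b_def)
      show "\<bar>b n\<bar> \<le> M" for n using bound[of n] by (simp add: b_def abs_mult power_abs)
      show "b (Suc n) = poly (- f) (int (Suc n)) * b n + poly h\<^sub>1 (int (Suc n))" for n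
        using rec[of n] that
        by (cases "even n") (simp_all add: b_def)
    qed
    then obtain c where "(\<forall>\<^sub>\<infinity>n. b n = c) \<or> (\<forall>n. b (2 * n) = c \<and> b (2 * n + 1) = 0)"
      by blast
    then show ?thesis
    proof
      assume "\<forall>\<^sub>\<infinity>n. b n = c"
      then have "\<forall>\<^sub>\<infinity>n. a n = (-1) ^ n * c"
        by eventually_elim (simp add: a_b)
      then show ?thesis by blast
    next
      \<comment> \<open>The sign is 1 at even indices and multiplies 0 at odd ones, so this
        alternative passes to \<open>a\<close> with the same \<open>c\<close>.\<close>
      assume "\<forall>n. b (2 * n) = c \<and> b (2 * n + 1) = 0"
      then have "\<forall>n. a (2 * n) = c \<and> a (2 * n + 1) = 0"
        by (simp add: a_b)
      then show ?thesis by blast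
    qed
  qed
  moreover have "(\<forall>\<^sub>\<infinity>n. a n = 0) \<or> (\<forall>n. a n = poly h\<^sub>1 0) \<or> (\<forall>n. a n = (-1) ^ n * poly h\<^sub>1 0)"
    if "h\<^sub>2 = 0"
    unfolding a_0[symmetric]
    by (rule bounded_homogeneous_recurrence[where f = f and M = M])
      (use rec bound that in simp_all)
  ultimately show ?thesis by blast
qed

end
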